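(* For every integer $n\ge 1$ the following congruences hold: $$C_{2n} \equiv 0 \pmod 2, \qquad C_{2n+1} \equiv C_n \pmod 2,$$ $$C_{2n} \equiv 2C_{n-1} \pmod 4, \qquad C_{2n+1} \equiv C_n \pmod 4,$$ $$C_{2n} \equiv 2(2n-1)C_{n-1} \pmod 8, \qquad C_{2n+1} \equiv C_n-4nC_{n-1} \pmod 8,$$ $$C_{2n} \equiv 2(2n-1)C_{n-1} + 8\binom{2n-1}{3} C_{n-2} \pmod{16}, \qquad C_{2n+1} \equiv C_n + 4n(2n-1)C_{n-1} \pmod{16},$$ where for $n=1$ the term $8\binom{2n-1}{3}C_{n-2}$ is read as $0$.
   Context: $C_n=\frac{1}{n+1}\binom{2n}{n}$ ($n\ge 0$) denotes the $n$-th Catalan number. *)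

theory Defs
  imports "HOL-Number_Theory.Cong"
begin

definition catalan :: "nat \<Rightarrow> nat"
  where "catalan n = (2 * n choose n) div (n + 1)"

(* The division in the definition is exact. *)
lemma Suc_mult_catalan: "(n + 1) * catalan n = (2 * n choose n)"
proof -
  have "(n + 1) * (2 * n choose Suc n) = n * (2 * n choose n)"
    using binomial_absorb_comp[of "2 * n" n] binomial_absorption[of n "2 * n"]
    by (simp add: mult_2)
  then have "(2 * n choose n) + (n + 1) * (2 * n choose Suc n) = (n + 1) * (2 * n choose n)"
    by simp
  then have "n + 1 dvd (2 * n choose n)"
    by (metis dvd_add_left_iff dvd_triv_left)
  then show ?thesis
    unfolding catalan_def by (rule dvd_mult_div_cancel)
qed

lemma of_nat_catalan:
  "(of_nat (catalan n) :: 'a :: field_char_0) = 1 / of_nat (n + 1) * of_nat (2 * n choose n)"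
proof -
  have "(of_nat (n + 1) :: 'a) * of_nat (catalan n) = of_nat (2 * n choose n)"
    unfolding of_nat_mult[symmetric] by (simp only: Suc_mult_catalan)
  moreover have "(of_nat (n + 1) :: 'a) \<noteq> 0"
    by (simp only: of_nat_eq_0_iff)
  ultimately show ?thesis
    by (metis nonzero_mult_div_cancel_left times_divide_eq_left mult_1)
qed

end

theory Submission
  imports Complex_Main Defs
begin

text \<open>
  Touchard's identity \<open>C (n + 1) = (\<Sum>k. (n choose 2k) * 2 ^ (n - 2k) * C k)\<close> gives all the
  congruences at once: modulo 16 only the two terms with the largest \<open>k\<close> survive. The identity
  is proved by creative telescoping: its right-hand side satisfies the first-order recurrence
  that characterises the Catalan numbers.
\<close>

section \<open>First-order recurrences for Catalan numbers and binomial coefficients\<close>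

lemma catalan_0 [simp]: "catalan 0 = 1"
  by (simp add: catalan_def)

text \<open>Absorption twice, with one reflection: binom(2k+2, k+1) = 2 binom(2k+1, k) and (k+1)
  binom(2k+1, k) = (2k+1) binom(2k, k). Together with C_0 = 1 this recurrence determines all Catalan
  numbers.\<close>

lemma catalan_Suc_mult: "(k + 2) * catalan (Suc k) = 2 * (2 * k + 1) * catalan k"
proof -
  have "Suc k * (2 * Suc k choose Suc k) = 2 * Suc k * (Suc (2 * k) choose k)"
    using Suc_times_binomial_eq[of "Suc (2 * k)" k] by (simp add: algebra_simps)
  then have "(2 * Suc k choose Suc k) = 2 * (Suc (2 * k) choose k)"
    by (metis mult.assoc mult.left_commute mult_left_cancel nat.distinct(1))
  moreover have "(Suc k) * (Suc (2 * k) choose k) = (2 * k + 1) * (2 * k choose k)"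
    using Suc_times_binomial_eq[of "2 * k" k] binomial_symmetric[of k "Suc (2 * k)"]
    by (simp add: Suc_diff_le mult.commute)
  ultimately have "Suc k * (2 * Suc k choose Suc k) = 2 * ((2 * k + 1) * (2 * k choose k))"
    by algebra
  then have "Suc k * ((k + 2) * catalan (Suc k)) = 2 * ((2 * k + 1) * ((k + 1) * catalan k))"
    unfolding Suc_mult_catalan[symmetric] by simp
  then have "Suc k * ((k + 2) * catalan (Suc k)) = Suc k * (2 * (2 * k + 1) * catalan k)"
    by (simp only: mult.left_commute mult.assoc Suc_eq_plus1)
  then show ?thesis
    by (metis mult_left_cancel nat.distinct(1))
qed

text \<open>The subtraction takes place in the ring, so the rule needs no assumption k <= n: for k >
  n both binomials vanish.\<close>

lemma Suc_times_binomial_Suc: "of_nat (Suc k) * of_nat (n choose Suc k)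
    = (of_nat n - of_nat k) * (of_nat (n choose k) :: 'a :: comm_ring_1)"
proof (cases "k \<le> n")
  case True
  have "Suc k * (n choose Suc k) = (n - k) * (n choose k)"
    by (metis binomial_absorb_comp binomial_absorption)
  then have "of_nat (Suc k * (n choose Suc k)) = (of_nat ((n - k) * (n choose k)) :: 'a)"
    by simp
  then show ?thesis
    using True unfolding of_nat_mult by (simp only: of_nat_diff)
qed (simp add: binomial_eq_0)

section \<open>Touchard's identity\<close>

text \<open>The quotient replaces 2 ^ (n - 2k). It scales by 2 in n and by 1/4 in k without
  truncation, and the binomial is zero whenever 2k > n.\<close>

definition touchard_summand :: "nat \<Rightarrow> nat \<Rightarrow> real" where
  "touchard_summand n k = real (n choose (2 * k)) * (2 ^ n / 4 ^ k) * real (catalan k)"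

text \<open>The last term is the certificate found by Zeilberger's algorithm.\<close>

lemma touchard_partial_sum:
  "(real n + 3) * (\<Sum>k\<le>m. touchard_summand (Suc n) k)
    = (4 * real n + 6) * (\<Sum>k\<le>m. touchard_summand n k)
      - 2 * (2 * real m + 1) * real (catalan m) * real (n choose (2 * m + 1)) * (2 ^ n / 4 ^ m)"
proof (induction m)
  case 0
  then show ?case
    by (simp add: touchard_summand_def algebra_simps)
next
  case (Suc m)
  define p :: real where "p = 2 ^ n / 4 ^ Suc m"
  define c where "c = real (catalan m)"
  define c' where "c' = real (catalan (Suc m))"
  define b0 where "b0 = real (n choose (2 * m + 1))"
  define b1 where "b1 = real (n choose (2 * m + 2))"
  define b2 where "b2 = real (n choose (2 * m + 3))"
  have c: "(real m + 2) * c' = 2 * (2 * real m + 1) * c"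
    unfolding c_def c'_def using arg_cong[OF catalan_Suc_mult[of m], of real] by (simp add: algebra_simps)
  have b1: "(2 * real m + 2) * b1 = (real n - 2 * real m - 1) * b0"
    using Suc_times_binomial_Suc[of "2 * m + 1" n, where 'a = real]
    unfolding b0_def b1_def by (simp add: algebra_simps)
  have b2: "(2 * real m + 3) * b2 = (real n - 2 * real m - 2) * b1"
    using Suc_times_binomial_Suc[of "2 * m + 2" n, where 'a = real]
    unfolding b1_def b2_def by (simp add: algebra_simps eval_nat_numeral)
  have F: "touchard_summand n (Suc m) = b1 * p * c'"
    by (simp add: touchard_summand_def b1_def p_def c'_def)
  have F': "touchard_summand (Suc n) (Suc m) = 2 * (b0 + b1) * p * c'"
    by (simp add: touchard_summand_def b0_def b1_def p_def c'_def field_simps)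
  have p4: "2 ^ n / 4 ^ m = 4 * p"
    by (simp add: p_def)
  \<comment> \<open>After Pascal's rule, \<open>b1\<close> is eliminated in favour of
    \<open>b0\<close> and \<open>b2\<close>. Multiplied by \<open>p * c'\<close>, the
    \<open>b2\<close> part is the certificate at m + 1; the \<open>b0\<close> part becomes the one
    at m once \<open>c\<close> rewrites (m + 2) C_(m+1).\<close>
  have "(real n + 3) * (2 * (b0 + b1)) - (4 * real n + 6) * b1
      = 4 * (real m + 2) * b0 - 2 * ((2 * real m + 3) * b2)"
    using b1 unfolding b2 by (simp add: algebra_simps)
  then have "((real n + 3) * (2 * (b0 + b1)) - (4 * real n + 6) * b1) * (p * c')
      = (4 * (real m + 2) * b0 - 2 * ((2 * real m + 3) * b2)) * (p * c')"
    by simp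
  moreover have "4 * (real m + 2) * b0 * (p * c') = 4 * b0 * p * (2 * (2 * real m + 1) * c)"
    unfolding c[symmetric] by simp
  ultimately have step: "(real n + 3) * (2 * (b0 + b1) * p * c')
      = (4 * real n + 6) * (b1 * p * c') - 2 * (2 * real m + 3) * c' * b2 * p
        + 2 * (2 * real m + 1) * c * b0 * (4 * p)"
    by (simp add: algebra_simps)
  have "n choose (2 * Suc m + 1) = n choose (2 * m + 3)"
    by (simp add: eval_nat_numeral)
  then have "2 * (2 * real (Suc m) + 1) * real (catalan (Suc m)) * real (n choose (2 * Suc m + 1))
      * (2 ^ n / 4 ^ Suc m) = 2 * (2 * real m + 3) * c' * b2 * p"
    unfolding c'_def b2_def p_def by simp
  then show ?case
    using Suc.IH step unfolding sum.atMost_Suc F F' p4 c_def[symmetric] b0_def[symmetric]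
    by (simp only: distrib_left)
qed

text \<open>Both sides obey the same recurrence in n and agree at n = 0. A summation bound m
  independent of n keeps the range fixed during the induction.\<close>

lemma touchard_real:
  assumes "n \<le> 2 * m"
  shows "real (catalan (Suc n)) = (\<Sum>k\<le>m. touchard_summand n k)"
  using assms
proof (induction n)
  case 0
  have "(\<Sum>k\<le>m. touchard_summand 0 k) = (\<Sum>k\<in>{0}. touchard_summand 0 k)"
    by (rule sum.mono_neutral_right) (auto simp: touchard_summand_def)
  then show ?case
    using catalan_Suc_mult[of 0] by (simp add: touchard_summand_def)
next
  case (Suc n)
  have "(real n + 3) * real (catalan (Suc (Suc n))) = (4 * real n + 6) * real (catalan (Suc n))"
    using arg_cong[OF catalan_Suc_mult[of "Suc n"], of real] by (simp add: algebra_simps)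
  \<comment> \<open>The certificate vanishes because n < 2m + 1.\<close>
  also have "\<dots> = (real n + 3) * (\<Sum>k\<le>m. touchard_summand (Suc n) k)"
    using Suc touchard_partial_sum[of n m] by (simp add: binomial_eq_0)
  finally show ?case
    by simp
qed

theorem touchard:
  "catalan (Suc n) = (\<Sum>k\<le>n div 2. (n choose (2 * k)) * 2 ^ (n - 2 * k) * catalan k)"
proof -
  have "touchard_summand n k = real ((n choose (2 * k)) * 2 ^ (n - 2 * k) * catalan k)"
    if "k \<le> n div 2" for k
  proof -
    have "(2::real) ^ n / 4 ^ k = 2 ^ (n - 2 * k)"
      using that by (simp add: power_diff power_mult)
    then show ?thesis
      by (simp add: touchard_summand_def)
  qed
  \<comment> \<open>For odd n the bound \<open>n div 2\<close> is too small for
    \<open>touchard_real\<close>; the extra term at \<open>Suc n div 2\<close> contains binom(n,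
    n+1) = 0.\<close>
  moreover have "real (catalan (Suc n)) = (\<Sum>k\<le>Suc n div 2. touchard_summand n k)"
    by (rule touchard_real) simp
  moreover have "\<dots> = (\<Sum>k\<le>n div 2. touchard_summand n k)"
    by (rule sum.mono_neutral_right) (auto simp: touchard_summand_def binomial_eq_0)
  ultimately have "real (catalan (Suc n))
      = real (\<Sum>k\<le>n div 2. (n choose (2 * k)) * 2 ^ (n - 2 * k) * catalan k)"
    by simp
  then show ?thesis
    by (simp only: of_nat_eq_iff)
qed

section \<open>Truncation of Touchard's sum modulo 16\<close>

lemma dvd_touchard_tail:
  assumes "\<And>k. k < m \<Longrightarrow> 2 * k + e \<le> n"
  shows "2 ^ e dvd (\<Sum>k<m. (n choose (2 * k)) * 2 ^ (n - 2 * k) * catalan k)"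
proof (rule dvd_sum)
  fix k assume "k \<in> {..<m}"
  then have "e \<le> n - 2 * k"
    using assms[of k] by simp
  then show "2 ^ e dvd (n choose (2 * k)) * 2 ^ (n - 2 * k) * catalan k"
    by (intro dvd_mult2 dvd_mult le_imp_power_dvd)
qed

text \<open>In Touchard's sum for index 2m + 2 the terms k = m and k = m + 1 carry 2^2 and 2^0;
  every earlier term carries at least 2^4 and goes into r.\<close>

lemma catalan_odd_expansion:
  obtains r where "catalan (2 * m + 3) = 16 * r + 4 * ((m + 1) * (2 * m + 1)) * catalan m
    + catalan (Suc m)"
proof -
  have "2 ^ 4 dvd (\<Sum>k<m. (2 * m + 2 choose (2 * k)) * 2 ^ (2 * m + 2 - 2 * k) * catalan k)"
    by (rule dvd_touchard_tail) simp
  then obtain r where r: "(\<Sum>k<m. (2 * m + 2 choose (2 * k)) * 2 ^ (2 * m + 2 - 2 * k) * catalan k)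
      = 16 * r"
    by auto
  have "2 * m + 2 choose (2 * m) = 2 * m + 2 choose 2"
    using binomial_symmetric[of "2 * m" "2 * m + 2"] by simp
  also have "\<dots> = (m + 1) * (2 * m + 1)"
    by (simp add: choose_two)
  finally have b: "2 * m + 2 choose (2 * m) = (m + 1) * (2 * m + 1)" .
  have "catalan (2 * m + 3) = (\<Sum>k\<le>Suc m. (2 * m + 2 choose (2 * k)) * 2 ^ (2 * m + 2 - 2 * k) * catalan k)"
  proof -
    have "Suc (2 * m + 2) = 2 * m + 3" "(2 * m + 2) div 2 = Suc m"
      by simp_all
    then show ?thesis
      using touchard[of "2 * m + 2"] by (simp only:)
  qed
  also have "\<dots> = 16 * r + 4 * ((m + 1) * (2 * m + 1)) * catalan m + catalan (Suc m)"
    using r b by (simp add: lessThan_Suc_atMost[symmetric])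
  finally show thesis
    by (rule that)
qed

text \<open>For index 2m + 3 the last two terms carry 2^3 and 2^1, and the earlier ones are again
  divisible by 16.\<close>

lemma catalan_even_expansion:
  obtains r where "catalan (2 * m + 4)
    = 16 * r + 8 * (2 * m + 3 choose 3) * catalan m + 2 * (2 * m + 3) * catalan (Suc m)"
proof -
  have "2 ^ 4 dvd (\<Sum>k<m. (2 * m + 3 choose (2 * k)) * 2 ^ (2 * m + 3 - 2 * k) * catalan k)"
    by (rule dvd_touchard_tail) simp
  then obtain r where r: "(\<Sum>k<m. (2 * m + 3 choose (2 * k)) * 2 ^ (2 * m + 3 - 2 * k) * catalan k)
      = 16 * r"
    by auto
  have b: "2 * m + 3 choose (2 * m) = 2 * m + 3 choose 3"
    using binomial_symmetric[of "2 * m" "2 * m + 3"] by simp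
  have b': "2 * m + 3 choose (2 * m + 2) = 2 * m + 3"
    using binomial_symmetric[of "2 * m + 2" "2 * m + 3"] by simp
  have "catalan (2 * m + 4) = (\<Sum>k\<le>Suc m. (2 * m + 3 choose (2 * k)) * 2 ^ (2 * m + 3 - 2 * k) * catalan k)"
  proof -
    have "Suc (2 * m + 3) = 2 * m + 4" "(2 * m + 3) div 2 = Suc m"
      by simp_all
    then show ?thesis
      using touchard[of "2 * m + 3"] by (simp only:)
  qed
  also have "\<dots> = 16 * r + 8 * (2 * m + 3 choose 3) * catalan m + 2 * (2 * m + 3) * catalan (Suc m)"
    using r b b' by (simp add: lessThan_Suc_atMost[symmetric])
  finally show thesis
    by (rule that)
qed

section \<open>The congruences\<close>

lemma catalan_odd_cong_16:
  assumes "n \<ge> 1"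
  shows "[int (catalan (2 * n + 1)) = int (catalan n)
    + 4 * int n * (2 * int n - 1) * int (catalan (n - 1))] (mod 16)"
proof -
  obtain m where n: "n = Suc m"
    using assms by (cases n) auto
  obtain r where "catalan (2 * m + 3)
      = 16 * r + 4 * ((m + 1) * (2 * m + 1)) * catalan m + catalan (Suc m)"
    by (rule catalan_odd_expansion)
  from arg_cong[OF this, of int] have "int (catalan (2 * n + 1))
      - (int (catalan n) + 4 * int n * (2 * int n - 1) * int (catalan (n - 1))) = 16 * int r"
    by (simp add: n algebra_simps eval_nat_numeral)
  then show ?thesis
    by (simp add: cong_iff_dvd_diff)
qed

lemma catalan_even_cong_16:
  assumes "n \<ge> 1"
  shows "[int (catalan (2 * n)) = 2 * (2 * int n - 1) * int (catalan (n - 1))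
    + (if n = 1 then 0
       else 8 * int ((2 * n - 1) choose 3) * int (catalan (n - 2)))] (mod 16)"
proof (cases "n = 1")
  case True
  \<comment> \<open>The even expansion starts at C_4, so n = 1 is checked directly: both sides equal
    2.\<close>
  have "catalan 2 = 2"
    using catalan_Suc_mult[of 1] catalan_Suc_mult[of 0] by (simp add: eval_nat_numeral)
  then show ?thesis
    using True by simp
next
  case False
  then obtain m where n: "n = m + 2"
    using assms by (metis add.commute le_Suc_ex le_antisym not_less_eq_eq one_add_one plus_1_eq_Suc)
  obtain r where "catalan (2 * m + 4)
      = 16 * r + 8 * (2 * m + 3 choose 3) * catalan m + 2 * (2 * m + 3) * catalan (Suc m)"
    by (rule catalan_even_expansion)
  from arg_cong[OF this, of int] have "int (catalan (2 * m + 4))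
      - (2 * (2 * int n - 1) * int (catalan (Suc m))
        + 8 * int (2 * m + 3 choose 3) * int (catalan m)) = 16 * int r"
    by (simp add: n algebra_simps)
  moreover have "2 * n = 2 * m + 4" "2 * n - 1 = 2 * m + 3" "n - 1 = Suc m" "n - 2 = m"
    by (simp_all add: n)
  ultimately show ?thesis
    using False by (simp only: cong_iff_dvd_diff if_False) simp
qed

theorem mainTheorem14:
  fixes n :: nat
  assumes "n \<ge> 1"
  shows "[int (catalan (2 * n)) = 0] (mod 2)
    \<and> [int (catalan (2 * n + 1)) = int (catalan n)] (mod 2)
    \<and> [int (catalan (2 * n)) = 2 * int (catalan (n - 1))] (mod 4)
    \<and> [int (catalan (2 * n + 1)) = int (catalan n)] (mod 4)
    \<and> [int (catalan (2 * n)) = 2 * (2 * int n - 1) * int (catalan (n - 1))] (mod 8)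
    \<and> [int (catalan (2 * n + 1)) = int (catalan n) - 4 * int n * int (catalan (n - 1))] (mod 8)
    \<and> [int (catalan (2 * n)) = 2 * (2 * int n - 1) * int (catalan (n - 1))
          + (if n = 1 then 0
             else 8 * int ((2 * n - 1) choose 3) * int (catalan (n - 2)))] (mod 16)
    \<and> [int (catalan (2 * n + 1)) = int (catalan n)
          + 4 * int n * (2 * int n - 1) * int (catalan (n - 1))] (mod 16)"
proof -
  define c where "c = int (catalan (n - 1))"
  define c' where "c' = int (catalan n)"
  define a where "a = int (catalan (2 * n))"
  define b where "b = int (catalan (2 * n + 1))"
  \<comment> \<open>The convention for n = 1 is absorbed into \<open>t\<close>; only 8t occurs
    below, which disappears modulo 2, 4 and 8.\<close>
  define t where "t = (if n = 1 then 0 else int ((2 * n - 1) choose 3) * int (catalan (n - 2)))"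
  have t: "(if n = 1 then 0 else 8 * int ((2 * n - 1) choose 3) * int (catalan (n - 2))) = 8 * t"
    by (simp add: t_def)
  have even16: "[a = 2 * (2 * int n - 1) * c + 8 * t] (mod 16)"
    using catalan_even_cong_16[OF assms] unfolding t a_def c_def .
  have odd16: "[b = c' + 4 * int n * (2 * int n - 1) * c] (mod 16)"
    using catalan_odd_cong_16[OF assms] unfolding b_def c_def c'_def .
  obtain r where r: "a = 2 * (2 * int n - 1) * c + 8 * t + 16 * r"
    using even16 by (metis cong_iff_lin cong_sym)
  obtain s where s: "b = c' + 4 * int n * (2 * int n - 1) * c + 16 * s"
    using odd16 by (metis cong_iff_lin cong_sym)
  \<comment> \<open>The weaker congruences follow from those modulo 16 by exhibiting each difference
    as a multiple of its modulus. The less obvious ones use 2(2n-1) - 2 = 4(n-1) and 4n(2n-1) + 4n =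
    8n^2.\<close>
  have "a - 0 = 2 * ((2 * int n - 1) * c + 4 * t + 8 * r)"
    "a - 2 * c = 4 * ((int n - 1) * c + 2 * t + 4 * r)"
    "a - 2 * (2 * int n - 1) * c = 8 * (t + 2 * r)"
    "b - c' = 2 * (2 * int n * (2 * int n - 1) * c + 8 * s)"
    "b - c' = 4 * (int n * (2 * int n - 1) * c + 4 * s)"
    "b - (c' - 4 * int n * c) = 8 * (int n * int n * c + 2 * s)"
    unfolding r s by (simp_all add: algebra_simps)
  then have "[a = 0] (mod 2)" "[a = 2 * c] (mod 4)" "[a = 2 * (2 * int n - 1) * c] (mod 8)"
    "[b = c'] (mod 2)" "[b = c'] (mod 4)" "[b = c' - 4 * int n * c] (mod 8)"
    unfolding cong_iff_dvd_diff by (metis dvd_triv_left)+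
  with even16 odd16 show ?thesis
    unfolding t a_def[symmetric] b_def[symmetric] c_def[symmetric] c'_def[symmetric] by blast
qed

end
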